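(* Let $\mathscr{G}=(V,E)$ be a finite undirected graph, and let $\mathscr{S}_G$ be the FTS constructed from $\mathscr{G}$ as described in the context. Let $\mathscr{S}'_G$ be an FTS with the minimal number of states among all FTS that are coherent branching feature bisimilar to $\mathscr{S}_G$. Then the number of states of $\mathscr{S}'_G$ equals the chromatic number of $\mathscr{G}$ plus $2$.
   Context: Feature transition systems (FTS): given features $\mathscr{F}$, products $\mathscr{P}\subseteq 2^{\mathscr{F}}$, actions $\mathscr{A}$ and silent action $\tau$ ($\mathscr{A}_\tau=\mathscr{A}\cup\{\tau\}$), an FTS is $(S,\theta,s^\circ)$ with $\theta:S\times\mathscr{A}_\tau\times S\to\mathbb{B}(\mathscr{F})$ (Boolean expressions over $\mathscr{F}$) and initial state $s^\circ$. $P\models\varphi$ means $\varphi$ is true when features in $P$ are true and others false; feature expressions are identified modulo $\varphi\sim_{\mathscr{P}}\psi$ (same products in $\mathscr{P}$ satisfy them), $\hat\varphi$ being the class. Write $s\xrightarrow{\alpha|\psi}s'$ if $\theta(s,\alpha,s')=\psi$ is satisfiable. The reachability function $\varrho$ satisfies: $P\models\varrho(s)$ iff $s$ is reachable from $s^\circ$ by transitions whose constraints $P$ satisfies. $s\Rightarrow_\eta s'$ denotes a possibly empty sequence of $\tau$-transitions from $s$ to $s'$ whose constraints have conjunction $\eta$; $s\xrightarrow{(\alpha|\psi)}s'$ means $s\xrightarrow{\alpha|\psi}s'$ or ($\alpha=\tau$, $s=s'$, $\psi=\mathit{true}$). A symmetric relation $R$ on states $\times$ classes of feature expressions $\times$ states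 (of the disjoint union of two FTS) is a branching feature bisimulation if whenever $R(s,\hat\varphi,t)$ and $s\xrightarrow{\alpha|\psi}s'$, there are $n$ and, for $i\le n$, $\hat t_i,t'_i,\eta_i,\psi_i,\varphi_i,\varphi'_i$ with $t\Rightarrow_{\eta_i}\hat t_i\xrightarrow{(\alpha|\psi_i)}t'_i$, $R(s,\hat\varphi_i,\hat t_i)$, $R(s',\hat\varphi'_i,t'_i)$, and every $P\in\mathscr{P}$ with $P\models\varphi\wedge\psi$ satisfies $\bigvee_i(\eta_i\wedge\psi_i\wedge\varphi_i\wedge\varphi'_i)$. It is coherent (for $\mathscr{S},\mathscr{S}'$) if $R(s,\hat\varphi,s')$ with $s$ in $\mathscr{S}$ implies every product satisfying $\varrho(s)$ satisfies $\varphi$. Two FTS are coherent branching feature bisimilar if such a coherent relation relates their initial states by $\widehat{\mathit{true}}$. Construction: $\mathscr{A}=\{a\}$, $\mathscr{F}=\{f_v\mid v\in V\}$, $\mathscr{P}=\{P_v\mid v\in V\}$ with $P_v=\{f_v\}$. $\mathscr{S}_G=(S_G,\theta_G,s_1)$ with $S_G=\{s_1,s_2\}\cup\{s_v\mid v\in V\}$ (all distinct), $\theta_G(s_1,a,s_v)=\bigvee\{f_u\mid \{u,v\}\in E\}\vee f_v$ for all $v\in V$, $\theta_G(s_v,a,s_2)=f_v$ for all $v\in V$, and $\theta_G(s,\alpha,s')=\mathit{false}$ in all other cases.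
   Formalization: The graph is assumed to be loop-free (otherwise the chromatic number is undefined) and to have at least one vertex: for the empty graph there are no products, a one-state FTS is bisimilar to S_G, and the claimed count 0+2 fails. *)

theory Defs
  imports Main "HOL-Library.Equipollence"
begin

section \<open>Feature expressions\<close>

datatype 'f fexp =
    FTrue
  | FFalse
  | Atom 'f
  | Neg "'f fexp"
  | And "'f fexp" "'f fexp"
  | Or "'f fexp" "'f fexp"

primrec sat :: "'f set \<Rightarrow> 'f fexp \<Rightarrow> bool" (infix \<open>\<Turnstile>\<close> 50) where
  "P \<Turnstile> FTrue \<longleftrightarrow> True"
| "P \<Turnstile> FFalse \<longleftrightarrow> False"
| "P \<Turnstile> Atom f \<longleftrightarrow> f \<in> P"
| "P \<Turnstile> Neg \<phi> \<longleftrightarrow> \<not> P \<Turnstile> \<phi>"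
| "P \<Turnstile> And \<phi> \<psi> \<longleftrightarrow> P \<Turnstile> \<phi> \<and> P \<Turnstile> \<psi>"
| "P \<Turnstile> Or \<phi> \<psi> \<longleftrightarrow> P \<Turnstile> \<phi> \<or> P \<Turnstile> \<psi>"

definition fexps :: "'f set \<Rightarrow> 'f fexp set" where
  "fexps F = {\<phi>. set_fexp \<phi> \<subseteq> F}"

text \<open>Disjunction of a finite set of expressions, in an arbitrary order.\<close>

definition big_or :: "'f fexp set \<Rightarrow> 'f fexp" where
  "big_or \<Phi> = foldr Or (SOME xs. set xs = \<Phi>) FFalse"

lemma set_some_list: "finite A \<Longrightarrow> set (SOME xs. set xs = A) = A"
  by (rule someI_ex) (rule finite_list)

lemma sat_big_or:
  assumes "finite \<Phi>"
  shows "P \<Turnstile> big_or \<Phi> \<longleftrightarrow> (\<exists>\<phi>\<in>\<Phi>. P \<Turnstile> \<phi>)"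
proof -
  have "P \<Turnstile> foldr Or xs FFalse \<longleftrightarrow> (\<exists>\<phi>\<in>set xs. P \<Turnstile> \<phi>)" for xs
    by (induction xs) auto
  then show ?thesis
    unfolding big_or_def by (simp add: set_some_list[OF assms])
qed

lemma big_or_in_fexps:
  assumes "finite \<Phi>" "\<Phi> \<subseteq> fexps F"
  shows "big_or \<Phi> \<in> fexps F"
proof -
  have "set xs \<subseteq> fexps F \<Longrightarrow> foldr Or xs FFalse \<in> fexps F" for xs
    by (induction xs) (auto simp: fexps_def)
  then show ?thesis
    unfolding big_or_def using assms(2) by (simp add: set_some_list[OF assms(1)])
qed

text \<open>In the following, \<open>F\<close> is the set of features and \<open>Ps\<close> the set of products.\<close>

definition feq :: "'f set \<Rightarrow> 'f set set \<Rightarrow> ('f fexp \<times> 'f fexp) set" where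
  "feq F Ps = {(\<phi>, \<psi>). \<phi> \<in> fexps F \<and> \<psi> \<in> fexps F \<and> (\<forall>P\<in>Ps. P \<Turnstile> \<phi> \<longleftrightarrow> P \<Turnstile> \<psi>)}"

lemma equiv_feq: "equiv (fexps F) (feq F Ps)"
  by (rule equivI) (auto simp: feq_def refl_on_def sym_def trans_def)

definition fclass :: "'f set \<Rightarrow> 'f set set \<Rightarrow> 'f fexp \<Rightarrow> 'f fexp set" where
  "fclass F Ps \<phi> = feq F Ps `` {\<phi>}"

text \<open>Satisfiability is relative to the products, so that it is invariant under \<open>feq\<close>.\<close>

definition satisfiable :: "'f set set \<Rightarrow> 'f fexp \<Rightarrow> bool" where
  "satisfiable Ps \<phi> \<longleftrightarrow> (\<exists>P\<in>Ps. P \<Turnstile> \<phi>)"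


section \<open>Feature transition systems\<close>

text \<open>The set of visible actions is the whole type \<open>'a\<close>.\<close>

datatype 'a act = Tau | Act 'a

record ('f, 'a, 's) fts =
  states :: "'s set"
  constr :: "'s \<Rightarrow> 'a act \<Rightarrow> 's \<Rightarrow> 'f fexp"
  init :: 's

definition is_fts :: "'f set \<Rightarrow> ('f, 'a, 's) fts \<Rightarrow> bool" where
  "is_fts F M \<longleftrightarrow>
     init M \<in> states M \<and>
     (\<forall>s\<in>states M. \<forall>\<alpha>. \<forall>s'\<in>states M. constr M s \<alpha> s' \<in> fexps F)"

definition step ::
  "'f set set \<Rightarrow> ('f, 'a, 's) fts \<Rightarrow> 's \<Rightarrow> 'a act \<Rightarrow> 'f fexp \<Rightarrow> 's \<Rightarrow> bool" where
  "step Ps M s \<alpha> \<psi> s' \<longleftrightarrow>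
     s \<in> states M \<and> s' \<in> states M \<and> constr M s \<alpha> s' = \<psi> \<and> satisfiable Ps \<psi>"

definition opt_step ::
  "'f set set \<Rightarrow> ('f, 'a, 's) fts \<Rightarrow> 's \<Rightarrow> 'a act \<Rightarrow> 'f fexp \<Rightarrow> 's \<Rightarrow> bool" where
  "opt_step Ps M s \<alpha> \<psi> s' \<longleftrightarrow>
     step Ps M s \<alpha> \<psi> s' \<or> (s \<in> states M \<and> \<alpha> = Tau \<and> s = s' \<and> \<psi> = FTrue)"

inductive tau_steps ::
  "'f set set \<Rightarrow> ('f, 'a, 's) fts \<Rightarrow> 's \<Rightarrow> 'f fexp \<Rightarrow> 's \<Rightarrow> bool"
  for Ps :: "'f set set" and M :: "('f, 'a, 's) fts" where
  empty: "s \<in> states M \<Longrightarrow> tau_steps Ps M s FTrue s"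
| cons: "step Ps M s Tau \<psi> s' \<Longrightarrow> tau_steps Ps M s' \<eta> s'' \<Longrightarrow> tau_steps Ps M s (And \<psi> \<eta>) s''"

inductive reachable ::
  "'f set set \<Rightarrow> ('f, 'a, 's) fts \<Rightarrow> 'f set \<Rightarrow> 's \<Rightarrow> bool"
  for Ps :: "'f set set" and M :: "('f, 'a, 's) fts" and P :: "'f set" where
  init: "reachable Ps M P (init M)"
| step: "reachable Ps M P s \<Longrightarrow> step Ps M s \<alpha> \<psi> s' \<Longrightarrow> P \<Turnstile> \<psi> \<Longrightarrow> reachable Ps M P s'"

text \<open>The reachability function is determined up to \<open>feq\<close>.\<close>

definition reach_fexp :: "'f set \<Rightarrow> 'f set set \<Rightarrow> ('f, 'a, 's) fts \<Rightarrow> 's \<Rightarrow> 'f fexp" where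
  "reach_fexp F Ps M s =
     (SOME \<rho>. \<rho> \<in> fexps F \<and> (\<forall>P\<in>Ps. P \<Turnstile> \<rho> \<longleftrightarrow> reachable Ps M P s))"

lemma fexp_of_products:
  fixes F :: "'f set"
  assumes "finite F" "Q \<subseteq> Pow F"
  shows "\<exists>\<phi>\<in>fexps F. \<forall>P\<subseteq>F. P \<Turnstile> \<phi> \<longleftrightarrow> P \<in> Q"
proof -
  define chi :: "'f set \<Rightarrow> 'f fexp"
    where "chi P = Neg (big_or ((\<lambda>f. if f \<in> P then Neg (Atom f) else Atom f) ` F))" for P
  have chi_fexps: "chi P \<in> fexps F" for P
  proof -
    have "big_or ((\<lambda>f. if f \<in> P then Neg (Atom f) else Atom f) ` F) \<in> fexps F"
      using assms(1) by (intro big_or_in_fexps finite_imageI image_subsetI) (simp_all add: fexps_def)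
    then show ?thesis by (simp add: chi_def fexps_def)
  qed
  have chi_sat: "P \<Turnstile> chi P' \<longleftrightarrow> P = P'" if "P \<subseteq> F" "P' \<subseteq> F" for P P'
  proof -
    have "P \<Turnstile> chi P' \<longleftrightarrow> (\<forall>f\<in>F. \<not> P \<Turnstile> (if f \<in> P' then Neg (Atom f) else Atom f))"
      unfolding chi_def by (simp only: sat.simps sat_big_or[OF finite_imageI[OF assms(1)]] bex_simps)
    also have "\<dots> \<longleftrightarrow> (\<forall>f\<in>F. f \<in> P \<longleftrightarrow> f \<in> P')"
      by (intro ball_cong refl) simp
    also have "\<dots> \<longleftrightarrow> P = P'"
    proof
      assume *: "\<forall>f\<in>F. f \<in> P \<longleftrightarrow> f \<in> P'"
      show "P = P'"
      proof (rule set_eqI)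
        show "f \<in> P \<longleftrightarrow> f \<in> P'" for f
          using * that by (cases "f \<in> F") (simp, meson subsetD)
      qed
    qed simp
    finally show ?thesis .
  qed
  have fin: "finite Q"
    by (rule finite_subset[OF assms(2)]) (simp add: assms(1))
  show ?thesis
  proof (intro bexI allI impI)
    show "big_or (chi ` Q) \<in> fexps F"
      using fin chi_fexps by (intro big_or_in_fexps finite_imageI image_subsetI)
    show "P \<Turnstile> big_or (chi ` Q) \<longleftrightarrow> P \<in> Q" if "P \<subseteq> F" for P
    proof -
      have "P \<Turnstile> big_or (chi ` Q) \<longleftrightarrow> (\<exists>P'\<in>Q. P \<Turnstile> chi P')"
        by (simp only: sat_big_or[OF finite_imageI[OF fin]] bex_simps)
      also have "\<dots> \<longleftrightarrow> (\<exists>P'\<in>Q. P = P')"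
        by (rule bex_cong[OF refl], rule chi_sat[OF that]) (use assms(2) in auto)
      finally show ?thesis by blast
    qed
  qed
qed

lemma reach_fexp:
  assumes "finite F" "Ps \<subseteq> Pow F"
  shows "reach_fexp F Ps M s \<in> fexps F"
    and "P \<in> Ps \<Longrightarrow> P \<Turnstile> reach_fexp F Ps M s \<longleftrightarrow> reachable Ps M P s"
proof -
  have "{P \<in> Ps. reachable Ps M P s} \<subseteq> Pow F"
    using assms(2) by auto
  from fexp_of_products[OF assms(1) this] obtain \<rho> where
    "\<rho> \<in> fexps F" "\<forall>P\<subseteq>F. P \<Turnstile> \<rho> \<longleftrightarrow> P \<in> {P \<in> Ps. reachable Ps M P s}" ..
  moreover have "\<forall>P\<in>Ps. P \<subseteq> F"
    using assms(2) by auto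
  ultimately have "\<exists>\<rho>. \<rho> \<in> fexps F \<and> (\<forall>P\<in>Ps. P \<Turnstile> \<rho> \<longleftrightarrow> reachable Ps M P s)"
    by (intro exI[of _ \<rho>]) simp
  then have *: "reach_fexp F Ps M s \<in> fexps F \<and>
      (\<forall>P\<in>Ps. P \<Turnstile> reach_fexp F Ps M s \<longleftrightarrow> reachable Ps M P s)"
    unfolding reach_fexp_def by (rule someI_ex)
  show "reach_fexp F Ps M s \<in> fexps F"
    using * by blast
  show "P \<in> Ps \<Longrightarrow> P \<Turnstile> reach_fexp F Ps M s \<longleftrightarrow> reachable Ps M P s"
    using * by blast
qed

fun union_constr ::
  "('f, 'a, 's) fts \<Rightarrow> ('f, 'a, 't) fts \<Rightarrow> 's + 't \<Rightarrow> 'a act \<Rightarrow> 's + 't \<Rightarrow> 'f fexp" where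
  "union_constr M N (Inl s) \<alpha> (Inl s') = constr M s \<alpha> s'"
| "union_constr M N (Inr t) \<alpha> (Inr t') = constr N t \<alpha> t'"
| "union_constr M N _ _ _ = FFalse"

text \<open>Only the states and transitions of the disjoint union are used; its initial state is
  a dummy.\<close>

definition fts_union :: "('f, 'a, 's) fts \<Rightarrow> ('f, 'a, 't) fts \<Rightarrow> ('f, 'a, 's + 't) fts" where
  "fts_union M N =
     \<lparr>states = states M <+> states N, constr = union_constr M N, init = Inl (init M)\<rparr>"


section \<open>Coherent branching feature bisimilarity\<close>

text \<open>The number \<open>n\<close> of matching runs may be 0, in which case the disjunction is false and
  no product satisfies \<open>And \<phi> \<psi>\<close>.\<close>

definition branching_feature_bisimulation ::
  "'f set \<Rightarrow> 'f set set \<Rightarrow> ('f, 'a, 's) fts \<Rightarrow> ('s \<times> 'f fexp set \<times> 's) set \<Rightarrow> bool" where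
  "branching_feature_bisimulation F Ps M R \<longleftrightarrow>
     R \<subseteq> states M \<times> (fexps F // feq F Ps) \<times> states M \<and>
     (\<forall>s c t. (s, c, t) \<in> R \<longrightarrow> (t, c, s) \<in> R) \<and>
     (\<forall>s t s' \<alpha>. \<forall>\<phi>\<in>fexps F. \<forall>\<psi>.
        (s, fclass F Ps \<phi>, t) \<in> R \<and> step Ps M s \<alpha> \<psi> s' \<longrightarrow>
        (\<exists>(n::nat) u t' \<eta> \<psi>' \<phi>1 \<phi>2.
           (\<forall>i\<in>{1..n}.
              tau_steps Ps M t (\<eta> i) (u i) \<and>
              opt_step Ps M (u i) \<alpha> (\<psi>' i) (t' i) \<and>
              \<phi>1 i \<in> fexps F \<and> (s, fclass F Ps (\<phi>1 i), u i) \<in> R \<and>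
              \<phi>2 i \<in> fexps F \<and> (s', fclass F Ps (\<phi>2 i), t' i) \<in> R) \<and>
           (\<forall>P\<in>Ps. P \<Turnstile> And \<phi> \<psi> \<longrightarrow>
              P \<Turnstile> big_or ((\<lambda>i. And (\<eta> i) (And (\<psi>' i) (And (\<phi>1 i) (\<phi>2 i)))) ` {1..n}))))"

text \<open>Coherence refers to reachability in the first system only.\<close>

definition coherent ::
  "'f set \<Rightarrow> 'f set set \<Rightarrow> ('f, 'a, 's) fts \<Rightarrow>
   (('s + 't) \<times> 'f fexp set \<times> ('s + 't)) set \<Rightarrow> bool" where
  "coherent F Ps M R \<longleftrightarrow>
     (\<forall>s\<in>states M. \<forall>t. \<forall>\<phi>\<in>fexps F. (Inl s, fclass F Ps \<phi>, t) \<in> R \<longrightarrow>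
        (\<forall>P\<in>Ps. P \<Turnstile> reach_fexp F Ps M s \<longrightarrow> P \<Turnstile> \<phi>))"

definition coherent_bf_bisimilar ::
  "'f set \<Rightarrow> 'f set set \<Rightarrow> ('f, 'a, 's) fts \<Rightarrow> ('f, 'a, 't) fts \<Rightarrow> bool" where
  "coherent_bf_bisimilar F Ps M N \<longleftrightarrow>
     (\<exists>R. branching_feature_bisimulation F Ps (fts_union M N) R \<and> coherent F Ps M R \<and>
          (Inl (init M), fclass F Ps FTrue, Inr (init N)) \<in> R)"

text \<open>HOL cannot quantify over the state type of the competitors \<open>L\<close>.  Ranging over state sets
  included in \<open>nat\<close> loses nothing for a finite \<open>M\<close>: every finite system is isomorphic to one of
  these, and an infinite competitor imposes no further constraint because (a copy of) \<open>M\<close>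
  itself is a finite competitor.\<close>

definition minimal_coherent_bf_bisimilar ::
  "'f set \<Rightarrow> 'f set set \<Rightarrow> ('f, 'a, 's) fts \<Rightarrow> ('f, 'a, 't) fts \<Rightarrow> bool" where
  "minimal_coherent_bf_bisimilar F Ps M N \<longleftrightarrow>
     is_fts F N \<and> coherent_bf_bisimilar F Ps M N \<and>
     (\<forall>L :: ('f, 'a, nat) fts. is_fts F L \<and> coherent_bf_bisimilar F Ps M L \<longrightarrow>
        states N \<lesssim> states L)"


section \<open>Graphs and the associated feature transition system\<close>

text \<open>Graphs are simple, since loops admit no proper colouring, and have a vertex: without
  vertices there are no products, and all systems are coherent branching feature bisimilar.\<close>

definition finite_graph :: "'v set \<Rightarrow> 'v set set \<Rightarrow> bool" where
  "finite_graph V E \<longleftrightarrow> finite V \<and> V \<noteq> {} \<and> (\<forall>e\<in>E. e \<subseteq> V \<and> card e = 2)"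

definition proper_colouring :: "'v set \<Rightarrow> 'v set set \<Rightarrow> nat \<Rightarrow> ('v \<Rightarrow> nat) \<Rightarrow> bool" where
  "proper_colouring V E k c \<longleftrightarrow>
     c ` V \<subseteq> {..<k} \<and> (\<forall>u\<in>V. \<forall>v\<in>V. {u, v} \<in> E \<longrightarrow> c u \<noteq> c v)"

definition chromatic_number :: "'v set \<Rightarrow> 'v set set \<Rightarrow> nat" where
  "chromatic_number V E = (LEAST k. \<exists>c. proper_colouring V E k c)"

datatype 'v feature = Feature 'v

definition graph_features :: "'v set \<Rightarrow> 'v feature set" where
  "graph_features V = {Feature v |v. v \<in> V}"

definition graph_products :: "'v set \<Rightarrow> 'v feature set set" where
  "graph_products V = {{Feature v} |v. v \<in> V}"

datatype 'v gstate = S1 | S2 | SV 'v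

text \<open>The alphabet is the one-element type \<open>unit\<close>.\<close>

fun graph_constr ::
  "'v set set \<Rightarrow> 'v gstate \<Rightarrow> unit act \<Rightarrow> 'v gstate \<Rightarrow> 'v feature fexp" where
  "graph_constr E S1 (Act ()) (SV v) =
     Or (big_or {Atom (Feature u) |u. {u, v} \<in> E}) (Atom (Feature v))"
| "graph_constr E (SV v) (Act ()) S2 = Atom (Feature v)"
| "graph_constr E _ _ _ = FFalse"

definition graph_fts :: "'v set \<Rightarrow> 'v set set \<Rightarrow> ('v feature, unit, 'v gstate) fts" where
  "graph_fts V E = \<lparr>states = {S1, S2} \<union> SV ` V, constr = graph_constr E, init = S1\<rparr>"

end

theory Submission
  imports Defs
begin

text \<open>
  Fixing a product turns a branching feature bisimulation into an ordinary branching bisimulation.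

  Upper bound: given a proper colouring, identify the states of vertices of equal colour. Under the
  product of a vertex \<open>u\<close>, a state \<open>SV v\<close> is reachable only if \<open>v\<close> equals or is adjacent to \<open>u\<close>, and
  only \<open>SV u\<close> can move. Since no neighbour of \<open>u\<close> shares its colour, no reachable state acquires
  new behaviour.

  Lower bound: let \<open>g v\<close> be a state of the competitor that answers the step from \<open>S1\<close> to \<open>SV v\<close>.
  By coherence \<open>g v\<close> is related to \<open>SV v\<close> for all products of the closed neighbourhood of \<open>v\<close>. If
  \<open>g u = g v\<close> for adjacent \<open>u\<close> and \<open>v\<close>, then \<open>SV u\<close> and \<open>SV v\<close> would be bisimilar for the product
  of \<open>u\<close>, where only the former can move. So \<open>g\<close> is a proper colouring, and it misses the initial
  state and the state answering \<open>S2\<close>.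
\<close>

section \<open>Bisimulations product by product\<close>

text \<open>Satisfiability is left out: a product in \<open>Ps\<close> that satisfies the constraint
  already witnesses it.\<close>

definition prod_step :: "'f set \<Rightarrow> ('f, 'a, 's) fts \<Rightarrow> 's \<Rightarrow> 'a act \<Rightarrow> 's \<Rightarrow> bool" where
  "prod_step P M s \<alpha> s' \<longleftrightarrow> s \<in> states M \<and> s' \<in> states M \<and> P \<Turnstile> constr M s \<alpha> s'"

text \<open>The slice of \<open>R\<close> at \<open>P\<close>. For \<open>P\<close> in
  \<open>Ps\<close> the representative chosen for a class does not matter, by
  \<open>fclass_eqD\<close>.\<close>

definition prod_rel ::
  "'f set \<Rightarrow> 'f set set \<Rightarrow> ('s \<times> 'f fexp set \<times> 's) set \<Rightarrow> 'f set \<Rightarrow> 's \<Rightarrow> 's \<Rightarrow> bool" where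
  "prod_rel F Ps R P s t \<longleftrightarrow> (\<exists>\<phi>\<in>fexps F. (s, fclass F Ps \<phi>, t) \<in> R \<and> P \<Turnstile> \<phi>)"

lemma prod_step_iff_step:
  "P \<in> Ps \<Longrightarrow> prod_step P M s \<alpha> s' \<longleftrightarrow> (\<exists>\<psi>. step Ps M s \<alpha> \<psi> s' \<and> P \<Turnstile> \<psi>)"
  by (auto simp: prod_step_def step_def satisfiable_def)

lemma tau_steps_prod_step:
  assumes "tau_steps Ps M t \<eta> u" "P \<Turnstile> \<eta>"
  shows "(\<lambda>x y. prod_step P M x Tau y)\<^sup>*\<^sup>* t u"
  using assms
proof induction
  case (cons s \<psi> s' \<eta> s'')
  then have "prod_step P M s Tau s'"
    by (auto simp: prod_step_def step_def)
  with cons show ?case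
    by (auto intro: converse_rtranclp_into_rtranclp)
qed auto

lemma fclass_eqD:
  assumes "fclass F Ps \<phi> = fclass F Ps \<psi>" "\<phi> \<in> fexps F" "P \<in> Ps"
  shows "P \<Turnstile> \<phi> \<longleftrightarrow> P \<Turnstile> \<psi>"
proof -
  have "\<phi> \<in> fclass F Ps \<phi>"
    using assms(2) by (auto simp: fclass_def feq_def)
  then show ?thesis
    using assms by (auto simp: fclass_def feq_def)
qed

lemma fclass_eqI:
  assumes "\<phi> \<in> fexps F" "\<psi> \<in> fexps F" "\<And>P. P \<in> Ps \<Longrightarrow> P \<Turnstile> \<phi> \<longleftrightarrow> P \<Turnstile> \<psi>"
  shows "fclass F Ps \<phi> = fclass F Ps \<psi>"
  using assms by (auto simp: fclass_def feq_def)

lemma bfb_sym: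
  assumes "branching_feature_bisimulation F Ps M R" "prod_rel F Ps R P s t"
  shows "prod_rel F Ps R P t s"
  using assms unfolding branching_feature_bisimulation_def prod_rel_def by blast

text \<open>A product satisfying \<open>And \<phi> \<psi>\<close> satisfies some disjunct of the
  covering condition. All constraints of that one run then hold for the product, so each slice is an
  ordinary branching bisimulation.\<close>

lemma bfb_prod_step:
  assumes bfb: "branching_feature_bisimulation F Ps M R" and P: "P \<in> Ps"
    and rel: "prod_rel F Ps R P s t" and st: "prod_step P M s \<alpha> s'"
  obtains u t' where "(\<lambda>x y. prod_step P M x Tau y)\<^sup>*\<^sup>* t u"
    "prod_step P M u \<alpha> t' \<or> \<alpha> = Tau \<and> u = t'"
    "prod_rel F Ps R P s u" "prod_rel F Ps R P s' t'"
proof -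
  obtain \<phi> where \<phi>: "\<phi> \<in> fexps F" "(s, fclass F Ps \<phi>, t) \<in> R" "P \<Turnstile> \<phi>"
    using rel by (auto simp: prod_rel_def)
  obtain \<psi> where \<psi>: "step Ps M s \<alpha> \<psi> s'" "P \<Turnstile> \<psi>"
    using st P by (auto simp: prod_step_iff_step)
  obtain n :: nat and u t' \<eta> \<psi>' \<phi>1 \<phi>2 where
    runs: "\<forall>i\<in>{1..n}. tau_steps Ps M t (\<eta> i) (u i) \<and> opt_step Ps M (u i) \<alpha> (\<psi>' i) (t' i) \<and>
        \<phi>1 i \<in> fexps F \<and> (s, fclass F Ps (\<phi>1 i), u i) \<in> R \<and>
        \<phi>2 i \<in> fexps F \<and> (s', fclass F Ps (\<phi>2 i), t' i) \<in> R"
    and cover: "\<forall>P\<in>Ps. P \<Turnstile> And \<phi> \<psi> \<longrightarrow>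
        P \<Turnstile> big_or ((\<lambda>i. And (\<eta> i) (And (\<psi>' i) (And (\<phi>1 i) (\<phi>2 i)))) ` {1..n})"
    using bfb[unfolded branching_feature_bisimulation_def, THEN conjunct2, THEN conjunct2,
        rule_format, OF \<phi>(1) conjI[OF \<phi>(2) \<psi>(1)]]
    by (elim exE conjE)
  obtain i where i: "i \<in> {1..n}" "P \<Turnstile> \<eta> i" "P \<Turnstile> \<psi>' i" "P \<Turnstile> \<phi>1 i" "P \<Turnstile> \<phi>2 i"
    using cover P \<phi>(3) \<psi>(2) by (auto simp: sat_big_or)
  show thesis
  proof
    show "(\<lambda>x y. prod_step P M x Tau y)\<^sup>*\<^sup>* t (u i)"
      using runs i(1,2) by (intro tau_steps_prod_step[of Ps M t "\<eta> i"]) auto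
    show "prod_step P M (u i) \<alpha> (t' i) \<or> \<alpha> = Tau \<and> u i = t' i"
      using runs i P unfolding opt_step_def by (metis prod_step_iff_step)
    show "prod_rel F Ps R P s (u i)" "prod_rel F Ps R P s' (t' i)"
      using runs i by (auto simp: prod_rel_def)
  qed
qed

text \<open>A partial converse, sufficient for the upper bound. Different products may need
  different matching states, but \<open>Ps\<close> is finite, so one run per product covers
  everything.\<close>

lemma strong_prod_bisimulation_imp_bfb:
  assumes fin: "finite Ps"
    and R: "R \<subseteq> states M \<times> (fexps F // feq F Ps) \<times> states M"
    and sym: "\<And>s c t. (s, c, t) \<in> R \<Longrightarrow> (t, c, s) \<in> R"
    and sim: "\<And>P s t \<alpha> s'. P \<in> Ps \<Longrightarrow> prod_rel F Ps R P s t \<Longrightarrow> prod_step P M s \<alpha> s' \<Longrightarrow>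
        \<exists>t'. prod_step P M t \<alpha> t' \<and> prod_rel F Ps R P s' t'"
  shows "branching_feature_bisimulation F Ps M R"
  unfolding branching_feature_bisimulation_def
proof (intro conjI allI ballI impI R)
  show "(t, c, s) \<in> R" if "(s, c, t) \<in> R" for s c t
    using sym that .
next
  fix s t s' \<alpha> \<phi> \<psi>
  assume \<phi>: "\<phi> \<in> fexps F" and "(s, fclass F Ps \<phi>, t) \<in> R \<and> step Ps M s \<alpha> \<psi> s'"
  then have st: "(s, fclass F Ps \<phi>, t) \<in> R" "step Ps M s \<alpha> \<psi> s'"
    by auto
  \<comment> \<open>\<open>Q\<close> holds the products that need a match. Run number
    \<open>i\<close> serves the product \<open>e i\<close>: it has an empty silent part, so it keeps
    \<open>t\<close> and \<open>\<phi>\<close>, and then takes a single transition. If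
    \<open>Q\<close> is empty, there are no runs.\<close>
  define Q where "Q = {P \<in> Ps. P \<Turnstile> And \<phi> \<psi>}"
  have "\<exists>t' \<phi>'. prod_step P M t \<alpha> t' \<and> \<phi>' \<in> fexps F \<and> (s', fclass F Ps \<phi>', t') \<in> R \<and> P \<Turnstile> \<phi>'"
    if "P \<in> Q" for P
  proof -
    have P: "P \<in> Ps" "prod_rel F Ps R P s t" "prod_step P M s \<alpha> s'"
      using that \<phi> st by (auto simp: Q_def prod_rel_def prod_step_iff_step)
    from sim[OF this] show ?thesis
      by (auto simp: prod_rel_def)
  qed
  then obtain T \<Phi> where T: "\<And>P. P \<in> Q \<Longrightarrow> prod_step P M t \<alpha> (T P) \<and> \<Phi> P \<in> fexps F \<and>
      (s', fclass F Ps (\<Phi> P), T P) \<in> R \<and> P \<Turnstile> \<Phi> P"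
    by metis
  have "finite Q"
    using fin by (simp add: Q_def)
  then obtain e where e: "bij_betw e {1..card Q} Q"
    using ex_bij_betw_nat_finite_1 by blast
  have eQ: "e i \<in> Q" if "i \<in> {1..card Q}" for i
    using bij_betwE[OF e] that by auto
  show "\<exists>(n::nat) u t' \<eta> \<psi>' \<phi>1 \<phi>2.
      (\<forall>i\<in>{1..n}. tau_steps Ps M t (\<eta> i) (u i) \<and> opt_step Ps M (u i) \<alpha> (\<psi>' i) (t' i) \<and>
         \<phi>1 i \<in> fexps F \<and> (s, fclass F Ps (\<phi>1 i), u i) \<in> R \<and>
         \<phi>2 i \<in> fexps F \<and> (s', fclass F Ps (\<phi>2 i), t' i) \<in> R) \<and>
      (\<forall>P\<in>Ps. P \<Turnstile> And \<phi> \<psi> \<longrightarrow>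
         P \<Turnstile> big_or ((\<lambda>i. And (\<eta> i) (And (\<psi>' i) (And (\<phi>1 i) (\<phi>2 i)))) ` {1..n}))"
  proof (rule exI[of _ "card Q"], rule exI[of _ "\<lambda>_. t"], rule exI[of _ "\<lambda>i. T (e i)"],
      rule exI[of _ "\<lambda>_. FTrue"], rule exI[of _ "\<lambda>i. constr M t \<alpha> (T (e i))"],
      rule exI[of _ "\<lambda>_. \<phi>"], rule exI[of _ "\<lambda>i. \<Phi> (e i)"], intro conjI ballI impI)
    fix i assume i: "i \<in> {1..card Q}"
    show "tau_steps Ps M t FTrue t"
      using st(1) R by (intro tau_steps.empty) auto
    show "opt_step Ps M t \<alpha> (constr M t \<alpha> (T (e i))) (T (e i))"
      using T[OF eQ[OF i]] eQ[OF i]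
      by (auto simp: opt_step_def step_def satisfiable_def prod_step_def Q_def)
    show "(s, fclass F Ps \<phi>, t) \<in> R" by (rule st)
    show "\<phi> \<in> fexps F" by (rule \<phi>)
    show "\<Phi> (e i) \<in> fexps F" "(s', fclass F Ps (\<Phi> (e i)), T (e i)) \<in> R"
      using T[OF eQ[OF i]] by auto
  next
    fix P assume "P \<in> Ps" "P \<Turnstile> And \<phi> \<psi>"
    then have "P \<in> Q" "P \<Turnstile> \<phi>"
      by (auto simp: Q_def)
    moreover from \<open>P \<in> Q\<close> obtain i where "i \<in> {1..card Q}" "e i = P"
      using e by (metis bij_betw_iff_bijections)
    ultimately show "P \<Turnstile> big_or ((\<lambda>i. And FTrue (And (constr M t \<alpha> (T (e i)))
        (And \<phi> (\<Phi> (e i))))) ` {1..card Q})"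
      using T[of P] by (force simp: sat_big_or prod_step_def)
  qed
qed

lemma prod_step_union_simps [simp]:
  "prod_step P (fts_union M N) (Inl s) \<alpha> (Inl s') \<longleftrightarrow> prod_step P M s \<alpha> s'"
  "prod_step P (fts_union M N) (Inr t) \<alpha> (Inr t') \<longleftrightarrow> prod_step P N t \<alpha> t'"
  "\<not> prod_step P (fts_union M N) (Inl s) \<alpha> (Inr t)"
  "\<not> prod_step P (fts_union M N) (Inr t) \<alpha> (Inl s)"
  by (auto simp: prod_step_def fts_union_def)

lemma reachable_prod_step:
  "P \<in> Ps \<Longrightarrow> reachable Ps M P s \<Longrightarrow> prod_step P M s \<alpha> s' \<Longrightarrow> reachable Ps M P s'"
  by (auto simp: prod_step_iff_step intro: reachable.step)

section \<open>Quotients\<close>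

text \<open>The quotient by the kernel of \<open>h\<close>, with the values of \<open>h\<close> as
  states. A map into \<open>nat\<close> thus yields a competitor of the type over which minimality
  quantifies.\<close>

definition quotient_fts :: "('s \<Rightarrow> 't) \<Rightarrow> ('f, 'a, 's) fts \<Rightarrow> ('f, 'a, 't) fts" where
  "quotient_fts h M = \<lparr>states = h ` states M,
     constr = \<lambda>x \<alpha> y. big_or ((\<lambda>(s, s'). constr M s \<alpha> s') `
       {(s, s') \<in> states M \<times> states M. h s = x \<and> h s' = y}),
     init = h (init M)\<rparr>"

lemma finite_state_pairs: "finite A \<Longrightarrow> finite {(s, s') \<in> A \<times> A. h s = x \<and> h s' = y}"
  by (rule finite_subset[of _ "A \<times> A"]) auto

lemma prod_step_quotient:
  assumes "finite (states M)"
  shows "prod_step P (quotient_fts h M) x \<alpha> y \<longleftrightarrow>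
    (\<exists>s s'. h s = x \<and> h s' = y \<and> prod_step P M s \<alpha> s')"
  using finite_state_pairs[OF assms, of h x y]
  by (auto simp: prod_step_def quotient_fts_def sat_big_or)

lemma is_fts_quotient:
  assumes "finite (states M)" "is_fts F M"
  shows "is_fts F (quotient_fts h M)"
  using assms finite_state_pairs[OF assms(1), of h]
  unfolding is_fts_def quotient_fts_def by (auto intro!: big_or_in_fexps)

text \<open>The quotient simulates the original automatically. The other direction is what
  \<open>lift\<close> provides, and it is demanded only for products that reach \<open>s\<close>,
  since coherence allows states to be related under these products alone.\<close>

lemma quotient_bisimilar:
  fixes M :: "('f, 'a, 's) fts" and h :: "'s \<Rightarrow> 't"
  assumes F: "finite F" "Ps \<subseteq> Pow F" and fin: "finite (states M)" and fts: "is_fts F M"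
    and lift: "\<And>P s r \<alpha> r'. P \<in> Ps \<Longrightarrow> reachable Ps M P s \<Longrightarrow> s \<in> states M \<Longrightarrow> h s = h r \<Longrightarrow>
        prod_step P M r \<alpha> r' \<Longrightarrow> \<exists>s'. h s' = h r' \<and> prod_step P M s \<alpha> s'"
  shows "coherent_bf_bisimilar F Ps M (quotient_fts h M)"
proof -
  define \<rho> where "\<rho> = reach_fexp F Ps M"
  have \<rho>: "\<rho> s \<in> fexps F" "P \<in> Ps \<Longrightarrow> P \<Turnstile> \<rho> s \<longleftrightarrow> reachable Ps M P s" for P s
    unfolding \<rho>_def by (fact reach_fexp[OF F])+
  let ?N = "quotient_fts h M"
  \<comment> \<open>The label \<open>\<rho> s\<close> is the strongest expression that coherence
    permits between \<open>s\<close> and its image. The second set makes the relation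
    symmetric.\<close>
  define R :: "(('s + 't) \<times> 'f fexp set \<times> ('s + 't)) set" where
    "R = (\<lambda>s. (Inl s, fclass F Ps (\<rho> s), Inr (h s))) ` states M \<union>
         (\<lambda>s. (Inr (h s), fclass F Ps (\<rho> s), Inl s)) ` states M"
  have rel: "prod_rel F Ps R P x y \<longleftrightarrow> (\<exists>s\<in>states M. reachable Ps M P s \<and>
      (x = Inl s \<and> y = Inr (h s) \<or> x = Inr (h s) \<and> y = Inl s))" (is "?lhs \<longleftrightarrow> ?rhs")
    if P: "P \<in> Ps" for P x y
  proof
    assume ?lhs
    then obtain \<phi> where \<phi>: "\<phi> \<in> fexps F" "(x, fclass F Ps \<phi>, y) \<in> R" "P \<Turnstile> \<phi>"
      by (auto simp: prod_rel_def)
    then obtain s where s: "s \<in> states M" "fclass F Ps \<phi> = fclass F Ps (\<rho> s)"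
      "x = Inl s \<and> y = Inr (h s) \<or> x = Inr (h s) \<and> y = Inl s"
      by (auto simp: R_def)
    then have "reachable Ps M P s"
      using fclass_eqD[OF s(2) \<phi>(1) P] \<phi>(3) \<rho>(2)[OF P] by blast
    with s show ?rhs by blast
  next
    assume ?rhs
    then show ?lhs
      unfolding prod_rel_def using \<rho> P by (auto simp: R_def)
  qed
  have fin_Ps: "finite Ps"
    using F finite_subset by auto
  have "branching_feature_bisimulation F Ps (fts_union M ?N) R"
  proof (rule strong_prod_bisimulation_imp_bfb[OF fin_Ps])
    show "R \<subseteq> states (fts_union M ?N) \<times> (fexps F // feq F Ps) \<times> states (fts_union M ?N)"
      using \<rho>(1) by (auto simp: R_def fts_union_def quotient_fts_def fclass_def intro: quotientI)
    show "(t, c, s) \<in> R" if "(s, c, t) \<in> R" for s c t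
      using that by (auto simp: R_def)
    fix P x y \<alpha> x'
    assume P: "P \<in> Ps" and "prod_rel F Ps R P x y" and st: "prod_step P (fts_union M ?N) x \<alpha> x'"
    then obtain s where s: "s \<in> states M" "reachable Ps M P s"
      "x = Inl s \<and> y = Inr (h s) \<or> x = Inr (h s) \<and> y = Inl s"
      unfolding rel[OF P] by blast
    from s(3) show "\<exists>y'. prod_step P (fts_union M ?N) y \<alpha> y' \<and> prod_rel F Ps R P x' y'"
    proof
      assume xy: "x = Inl s \<and> y = Inr (h s)"
      with st obtain s' where s': "x' = Inl s'" "prod_step P M s \<alpha> s'"
        by (cases x') auto
      then have "prod_step P ?N (h s) \<alpha> (h s')"
        unfolding prod_step_quotient[OF fin] by blast
      moreover have "prod_rel F Ps R P x' (Inr (h s'))"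
        unfolding rel[OF P] using s' reachable_prod_step[OF P s(2)] by (auto simp: prod_step_def)
      ultimately show ?thesis
        using xy by (intro exI[of _ "Inr (h s')"]) simp
    next
      assume xy: "x = Inr (h s) \<and> y = Inl s"
      with st obtain t' where t': "x' = Inr t'" "prod_step P ?N (h s) \<alpha> t'"
        by (cases x') auto
      then obtain r r' where r: "h s = h r" "h r' = t'" "prod_step P M r \<alpha> r'"
        unfolding prod_step_quotient[OF fin] by metis
      \<comment> \<open>The quotient step may originate in another member \<open>r\<close> of the
        block of \<open>s\<close>; \<open>lift\<close> transfers it to \<open>s\<close>.\<close>
      from lift[OF P s(2,1) r(1,3)] obtain s' where s': "h s' = t'" "prod_step P M s \<alpha> s'"
        using r(2) by blast
      then have "prod_rel F Ps R P x' (Inl s')"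
        unfolding rel[OF P] using t' reachable_prod_step[OF P s(2)] by (auto simp: prod_step_def)
      then show ?thesis
        using xy s' by (intro exI[of _ "Inl s'"]) simp
    qed
  qed
  moreover have "coherent F Ps M R"
    unfolding coherent_def
  proof (intro ballI allI impI)
    fix s t \<phi> P
    assume "\<phi> \<in> fexps F" "(Inl s, fclass F Ps \<phi>, t) \<in> R" "P \<in> Ps" "P \<Turnstile> reach_fexp F Ps M s"
    then show "P \<Turnstile> \<phi>"
      using fclass_eqD[of F Ps \<phi> "\<rho> s" P] by (auto simp: R_def \<rho>_def)
  qed
  moreover have "(Inl (init M), fclass F Ps FTrue, Inr (init ?N)) \<in> R"
  proof -
    \<comment> \<open>Every product reaches the initial state, so its label is equivalent to
      true.\<close>
    have "fclass F Ps FTrue = fclass F Ps (\<rho> (init M))"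
      using \<rho> by (intro fclass_eqI) (auto simp: fexps_def intro: reachable.init)
    then show ?thesis
      using fts by (auto simp: R_def quotient_fts_def is_fts_def)
  qed
  ultimately show ?thesis
    unfolding coherent_bf_bisimilar_def by blast
qed

section \<open>States without silent steps\<close>

text \<open>A state without silent steps can answer a silent step only by staying where it is, so
  the relation to it survives along the whole silent run.\<close>

lemma tau_free_preserved:
  assumes bfb: "branching_feature_bisimulation F Ps M R" and P: "P \<in> Ps"
    and free: "\<And>s'. \<not> prod_step P M s Tau s'"
    and "(\<lambda>x y. prod_step P M x Tau y)\<^sup>*\<^sup>* t u" "prod_rel F Ps R P s t"
  shows "prod_rel F Ps R P s u"
  using assms(4,5)
proof (induction rule: rtranclp_induct)
  case (step y z)
  have "prod_rel F Ps R P y s"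
    using bfb_sym[OF bfb] step by blast
  from bfb_prod_step[OF bfb P this step.hyps(2)] obtain u s' where
    *: "(\<lambda>x y. prod_step P M x Tau y)\<^sup>*\<^sup>* s u" "prod_step P M u Tau s' \<or> u = s'"
    "prod_rel F Ps R P z s'"
    by metis
  have "u = s"
    using *(1) free by (auto elim: converse_rtranclpE)
  with * free have "prod_rel F Ps R P z s"
    by auto
  then show ?case
    by (rule bfb_sym[OF bfb])
qed

text \<open>Branching bisimilarity of two states without silent steps is witnessed by a common third
  state; stating it so avoids proving transitivity.\<close>

lemma common_related_step:
  assumes bfb: "branching_feature_bisimulation F Ps M R" and P: "P \<in> Ps"
    and free: "\<And>r'. \<not> prod_step P M r Tau r'"
    and rel: "prod_rel F Ps R P s t" "prod_rel F Ps R P r t"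
    and st: "prod_step P M s (Act a) s'"
  obtains r' t' where "prod_step P M r (Act a) r'" "prod_rel F Ps R P s' t'"
    "prod_rel F Ps R P r' t'"
proof -
  obtain u t' where u: "(\<lambda>x y. prod_step P M x Tau y)\<^sup>*\<^sup>* t u" "prod_step P M u (Act a) t'"
    "prod_rel F Ps R P s' t'"
    using bfb_prod_step[OF bfb P rel(1) st] by (metis act.distinct(1))
  \<comment> \<open>The silent run from \<open>t\<close> to \<open>u\<close>, made to answer
    \<open>s\<close>, does not lose the relation to \<open>r\<close>; hence \<open>r\<close> must
    answer the visible step of \<open>u\<close>.\<close>
  have "prod_rel F Ps R P u r"
    using tau_free_preserved[OF bfb P free u(1) rel(2)] by (rule bfb_sym[OF bfb])
  from bfb_prod_step[OF bfb P this u(2)] obtain w r' where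
    w: "(\<lambda>x y. prod_step P M x Tau y)\<^sup>*\<^sup>* r w" "prod_step P M w (Act a) r'"
    "prod_rel F Ps R P t' r'"
    by (metis act.distinct(1))
  have "w = r"
    using w(1) free by (auto elim: converse_rtranclpE)
  with w u that bfb_sym[OF bfb] show thesis
    by blast
qed

text \<open>The answer is found for the single product \<open>P\<close>, but coherence forces its
  label to hold for every product reaching \<open>s'\<close>. Hence one \<open>t'\<close> serves all
  these products at once.\<close>

lemma coherent_step:
  fixes M :: "('f, 'a, 's) fts" and N :: "('f, 'a, 't) fts"
  assumes F: "finite F" "Ps \<subseteq> Pow F"
    and bfb: "branching_feature_bisimulation F Ps (fts_union M N) R"
    and coh: "coherent F Ps M R" and P: "P \<in> Ps"
    and rel: "prod_rel F Ps R P (Inl s) (Inr t)" and st: "prod_step P M s (Act a) s'"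
  obtains t' where "t' \<in> states N"
    "\<And>Q. Q \<in> Ps \<Longrightarrow> reachable Ps M Q s' \<Longrightarrow> prod_rel F Ps R Q (Inl s') (Inr t')"
proof -
  have "prod_step P (fts_union M N) (Inl s) (Act a) (Inl s')"
    using st by simp
  from bfb_prod_step[OF bfb P rel this] obtain u y where
    u: "(\<lambda>x y. prod_step P (fts_union M N) x Tau y)\<^sup>*\<^sup>* (Inr t) u"
    "prod_step P (fts_union M N) u (Act a) y" "prod_rel F Ps R P (Inl s') y"
    by (metis act.distinct(1))
  \<comment> \<open>The disjoint union has no transitions between its components.\<close>
  have "\<exists>t'. u = Inr t'"
    using u(1)
  proof (induction rule: rtranclp_induct)
    case (step x z)
    then show ?case by (cases z) auto
  qed simp
  then obtain t' where t': "y = Inr t'" "t' \<in> states N"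
    using u(2) by (cases y) (auto simp: prod_step_def fts_union_def)
  obtain \<phi> where \<phi>: "\<phi> \<in> fexps F" "(Inl s', fclass F Ps \<phi>, Inr t') \<in> R"
    using u(3) t'(1) by (auto simp: prod_rel_def)
  have "prod_rel F Ps R Q (Inl s') (Inr t')" if "Q \<in> Ps" "reachable Ps M Q s'" for Q
  proof -
    have "Q \<Turnstile> \<phi>"
      using coh that \<phi> st reach_fexp(2)[OF F, of Q M s']
      unfolding coherent_def prod_step_def by blast
    with \<phi> show ?thesis
      by (auto simp: prod_rel_def)
  qed
  with t'(2) that show thesis
    by blast
qed

section \<open>The system of a graph\<close>

lemma finite_neighbour_atoms:
  assumes "finite_graph V E"
  shows "finite {Atom (Feature w) |w. {w, v} \<in> E}"
proof (rule finite_subset)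
  show "{Atom (Feature w) |w. {w, v} \<in> E} \<subseteq> (\<lambda>w. Atom (Feature w)) ` V"
    using assms by (auto simp: finite_graph_def)
  show "finite ((\<lambda>w. Atom (Feature w)) ` V)"
    using assms by (auto simp: finite_graph_def)
qed

text \<open>Under the product of \<open>u\<close> the only true atom is \<open>Feature u\<close>, so
  the constraints collapse to adjacency or equality with \<open>u\<close>.\<close>

lemma prod_step_graph:
  assumes "finite_graph V E" "u \<in> V"
  shows "prod_step {Feature u} (graph_fts V E) s \<alpha> s' \<longleftrightarrow> \<alpha> = Act () \<and>
    (s = S1 \<and> (\<exists>v\<in>V. s' = SV v \<and> ({u, v} \<in> E \<or> u = v)) \<or> s = SV u \<and> s' = S2)"
proof -
  have big: "{Feature u} \<Turnstile> big_or {Atom (Feature w) |w. {w, v} \<in> E} \<longleftrightarrow> {u, v} \<in> E" for v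
    by (auto simp: sat_big_or[OF finite_neighbour_atoms[OF assms(1)]])
  show ?thesis
    using assms(2) by (cases s; cases \<alpha>; cases s')
      (auto simp: prod_step_def graph_fts_def big)
qed

lemma graph_features_products:
  assumes "finite_graph V E"
  shows "finite (graph_features V)" "graph_products V \<subseteq> Pow (graph_features V)"
  using assms by (auto simp: graph_features_def graph_products_def finite_graph_def)

lemma is_fts_graph:
  assumes "finite_graph V E"
  shows "is_fts (graph_features V) (graph_fts V E)"
proof -
  have V: "w \<in> V" if "{w, v} \<in> E" for v w
    using that assms by (auto simp: finite_graph_def)
  have "{Atom (Feature w) |w. {w, v} \<in> E} \<subseteq> fexps (graph_features V)" for v
    by (auto simp: fexps_def graph_features_def dest: V)
  then have "big_or {Atom (Feature w) |w. {w, v} \<in> E} \<in> fexps (graph_features V)" for v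
    by (intro big_or_in_fexps finite_neighbour_atoms[OF assms])
  then have "graph_constr E s \<alpha> s' \<in> fexps (graph_features V)"
    if "s \<in> states (graph_fts V E)" "s' \<in> states (graph_fts V E)" for s \<alpha> s'
    using that
    by (cases "(E, s, \<alpha>, s')" rule: graph_constr.cases)
      (auto simp: fexps_def graph_features_def graph_fts_def)
  then show ?thesis
    by (simp add: is_fts_def graph_fts_def)
qed

text \<open>Transitions into \<open>SV v\<close> leave only the initial state, so case analysis on
  the last step replaces induction.\<close>

lemma reachable_graph_SV:
  assumes "finite_graph V E" "u \<in> V"
  shows "reachable (graph_products V) (graph_fts V E) {Feature u} (SV v) \<longleftrightarrow>
    v \<in> V \<and> ({u, v} \<in> E \<or> u = v)"
proof -
  have P: "{Feature u} \<in> graph_products V"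
    using assms(2) by (auto simp: graph_products_def)
  note st = prod_step_graph[OF assms]
  show ?thesis
  proof
    assume "reachable (graph_products V) (graph_fts V E) {Feature u} (SV v)"
    then show "v \<in> V \<and> ({u, v} \<in> E \<or> u = v)"
    proof cases
      case init
      then show ?thesis by (simp add: graph_fts_def)
    next
      case (step s \<alpha> \<psi>)
      then have "prod_step {Feature u} (graph_fts V E) s \<alpha> (SV v)"
        using P by (auto simp: prod_step_iff_step)
      then show ?thesis
        by (auto simp: st)
    qed
  next
    assume "v \<in> V \<and> ({u, v} \<in> E \<or> u = v)"
    then have "prod_step {Feature u} (graph_fts V E) (init (graph_fts V E)) (Act ()) (SV v)"
      by (auto simp: st) (auto simp: graph_fts_def)
    with P show "reachable (graph_products V) (graph_fts V E) {Feature u} (SV v)"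
      by (blast intro: reachable_prod_step reachable.init)
  qed
qed

text \<open>Each product gets to \<open>S2\<close> through its own vertex. Coherence therefore
  relates \<open>S2\<close> to its answering state under all products.\<close>

lemma reachable_graph_S2:
  assumes "finite_graph V E" "u \<in> V"
  shows "reachable (graph_products V) (graph_fts V E) {Feature u} S2"
proof -
  have "reachable (graph_products V) (graph_fts V E) {Feature u} (SV u)"
    using assms by (simp add: reachable_graph_SV)
  moreover have "prod_step {Feature u} (graph_fts V E) (SV u) (Act ()) S2"
    using assms by (simp add: prod_step_graph)
  moreover have "{Feature u} \<in> graph_products V"
    using assms(2) by (auto simp: graph_products_def)
  ultimately show ?thesis
    by (blast intro: reachable_prod_step)
qed

section \<open>Upper bound: a small bisimilar system from a proper colouring\<close>

lemma colouring_bisimilar: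
  assumes G: "finite_graph V E" and c: "proper_colouring V E k c"
  obtains L :: "('v feature, unit, nat) fts" where
    "is_fts (graph_features V) L" "finite (states L)" "card (states L) \<le> k + 2"
    "coherent_bf_bisimilar (graph_features V) (graph_products V) (graph_fts V E) L"
proof
  \<comment> \<open>Colours lie below \<open>k\<close>, so \<open>k\<close> and \<open>k + 1\<close>
    are fresh values for \<open>S1\<close> and \<open>S2\<close>.\<close>
  define h where "h s = (case s of S1 \<Rightarrow> k | S2 \<Rightarrow> k + 1 | SV v \<Rightarrow> c v)" for s
  let ?M = "graph_fts V E"
  let ?L = "quotient_fts h ?M"
  have fin: "finite (states ?M)"
    using G by (auto simp: finite_graph_def graph_fts_def)
  show "is_fts (graph_features V) ?L"
    using fin is_fts_graph[OF G] by (rule is_fts_quotient)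
  show "finite (states ?L)"
    using fin by (simp add: quotient_fts_def)
  have ck: "c v < k" if "v \<in> V" for v
    using c that by (auto simp: proper_colouring_def)
  have "states ?L \<subseteq> {..<k + 2}"
    using ck by (fastforce simp: quotient_fts_def graph_fts_def h_def)
  from card_mono[OF _ this] show "card (states ?L) \<le> k + 2"
    by simp
  show "coherent_bf_bisimilar (graph_features V) (graph_products V) ?M ?L"
  proof (rule quotient_bisimilar[OF graph_features_products[OF G] fin is_fts_graph[OF G]])
    fix P s r \<alpha> r'
    assume "P \<in> graph_products V" and reach: "reachable (graph_products V) ?M P s"
      and s: "s \<in> states ?M" and h: "h s = h r" and st: "prod_step P ?M r \<alpha> r'"
    then obtain u where u: "u \<in> V" "P = {Feature u}"
      by (auto simp: graph_products_def)
    note step_iff = prod_step_graph[OF G u(1)]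
    \<comment> \<open>The lifting condition becomes trivial: a state that can move shares its value
      of \<open>h\<close> with no other reachable state. For \<open>r = SV u\<close>, reachability
      makes \<open>v\<close> equal or adjacent to \<open>u\<close>, and equal colours exclude
      adjacency.\<close>
    have "s = r"
    proof (cases "r = S1")
      case True
      then show ?thesis
        using h s ck by (fastforce simp: h_def graph_fts_def)
    next
      case False
      then have r: "r = SV u"
        using st u by (auto simp: step_iff)
      then obtain v where v: "s = SV v" "v \<in> V" "c v = c u"
        using h s ck[OF u(1)] by (auto simp: h_def graph_fts_def)
      then have "{u, v} \<in> E \<or> u = v"
        using reach u reachable_graph_SV[OF G u(1)] by auto
      then show ?thesis
        using c u(1) v r unfolding proper_colouring_def by metis
    qed
    with st show "\<exists>s'. h s' = h r' \<and> prod_step P ?M s \<alpha> s'"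
      by blast
  qed
qed

section \<open>Lower bound: a proper colouring from a bisimilar system\<close>

text \<open>Numbering the image turns a colouring with arbitrary values, such as states of a
  competitor, into one by natural numbers.\<close>

lemma proper_colouring_of_map:
  assumes "finite V" "\<And>u v. u \<in> V \<Longrightarrow> v \<in> V \<Longrightarrow> {u, v} \<in> E \<Longrightarrow> g u \<noteq> g v"
  obtains c where "proper_colouring V E (card (g ` V)) c"
proof -
  obtain e where e: "bij_betw e (g ` V) {0..<card (g ` V)}"
    using ex_bij_betw_finite_nat[of "g ` V"] assms(1) by blast
  have "e (g v) < card (g ` V)" if "v \<in> V" for v
    using bij_betwE[OF e] that by auto
  moreover have "e (g u) \<noteq> e (g v)" if "u \<in> V" "v \<in> V" "{u, v} \<in> E" for u v
    using that assms(2) inj_onD[OF bij_betw_imp_inj_on[OF e]] by blast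
  ultimately have "proper_colouring V E (card (g ` V)) (e \<circ> g)"
    by (auto simp: proper_colouring_def)
  then show thesis
    by (rule that)
qed

lemma bisimilar_card_ge:
  fixes N :: "('v feature, unit, 't) fts"
  assumes G: "finite_graph V E" and N: "is_fts (graph_features V) N" "finite (states N)"
    and bis: "coherent_bf_bisimilar (graph_features V) (graph_products V) (graph_fts V E) N"
  shows "chromatic_number V E + 2 \<le> card (states N)"
proof -
  let ?F = "graph_features V" and ?Ps = "graph_products V" and ?M = "graph_fts V E"
  note F = graph_features_products[OF G]
  obtain R where bfb: "branching_feature_bisimulation ?F ?Ps (fts_union ?M N) R"
    and coh: "coherent ?F ?Ps ?M R"
    and ini: "(Inl S1, fclass ?F ?Ps FTrue, Inr (init N)) \<in> R"
    using bis by (auto simp: coherent_bf_bisimilar_def graph_fts_def)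
  define rel where "rel u s t \<longleftrightarrow> prod_rel ?F ?Ps R {Feature u} (Inl s) (Inr t)" for u s t
  have P: "{Feature u} \<in> ?Ps" if "u \<in> V" for u
    using that by (auto simp: graph_products_def)
  have rel_S1: "rel u S1 (init N)" for u
    using ini unfolding rel_def prod_rel_def by (force simp: fexps_def)
  \<comment> \<open>The witness \<open>t\<close> ranges over both components, since
    \<open>common_related_step\<close> does not say in which one the next witness lies.\<close>
  define bisim where "bisim u s r \<longleftrightarrow> (\<exists>t. prod_rel ?F ?Ps R {Feature u} (Inl s) t \<and>
      prod_rel ?F ?Ps R {Feature u} (Inl r) t)" for u s r
  have bisimI: "bisim u s r" if "rel u s t" "rel u r t" for u s r t
    using that by (auto simp: bisim_def rel_def)
  have bisim_step: "\<exists>r'. prod_step {Feature u} ?M r (Act ()) r' \<and> bisim u s' r'"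
    if u: "u \<in> V" and "bisim u s r" and st: "prod_step {Feature u} ?M s (Act ()) s'" for u s r s'
  proof -
    obtain t where t: "prod_rel ?F ?Ps R {Feature u} (Inl s) t"
      "prod_rel ?F ?Ps R {Feature u} (Inl r) t"
      using \<open>bisim u s r\<close> by (auto simp: bisim_def)
    have free: "\<not> prod_step {Feature u} (fts_union ?M N) (Inl r) Tau x" for x
      by (cases x) (auto simp: prod_step_graph[OF G u])
    have "prod_step {Feature u} (fts_union ?M N) (Inl s) (Act ()) (Inl s')"
      using st by simp
    from common_related_step[OF bfb P[OF u] free t this] obtain x t' where
      x: "prod_step {Feature u} (fts_union ?M N) (Inl r) (Act ()) x"
      "prod_rel ?F ?Ps R {Feature u} (Inl s') t'" "prod_rel ?F ?Ps R {Feature u} x t'"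
      by blast
    then show ?thesis
      by (cases x) (auto simp: bisim_def)
  qed
  \<comment> \<open>The first three separations need one step: under the product of
    \<open>u\<close>, both \<open>S1\<close> and \<open>SV u\<close> can move, whereas
    \<open>S2\<close> and every other \<open>SV v\<close> cannot.\<close>
  have not_S1_S2: "\<not> bisim u S1 S2" if "u \<in> V" for u
    using bisim_step[OF that, of S1 S2 "SV u"] that by (auto simp: prod_step_graph[OF G that])
  have not_SV_S2: "\<not> bisim u (SV u) S2" if "u \<in> V" for u
    using bisim_step[OF that, of "SV u" S2 S2] that by (auto simp: prod_step_graph[OF G that])
  have not_SV_SV: "\<not> bisim u (SV u) (SV v)" if "u \<in> V" "u \<noteq> v" for u v
    using bisim_step[OF that(1), of "SV u" "SV v" S2] that
    by (auto simp: prod_step_graph[OF G that(1)])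
  \<comment> \<open>Both states can move here, so two steps are needed: \<open>S1\<close> can go to
    \<open>SV u\<close>, which moves again, but \<open>SV u\<close> can only answer with
    \<open>S2\<close>.\<close>
  have not_S1_SV: "\<not> bisim u S1 (SV u)" if "u \<in> V" for u
    using bisim_step[OF that, of S1 "SV u" "SV u"] that not_SV_S2[OF that]
    by (auto simp: prod_step_graph[OF G that])

  have "\<exists>t\<in>states N. \<forall>u\<in>V. {u, v} \<in> E \<or> u = v \<longrightarrow> rel u (SV v) t" if v: "v \<in> V" for v
  proof -
    have "prod_step {Feature v} ?M S1 (Act ()) (SV v)"
      using v by (auto simp: prod_step_graph[OF G v])
    from coherent_step[OF F bfb coh P[OF v] rel_S1[of v, unfolded rel_def] this]
    obtain t where t: "t \<in> states N" "\<And>Q. Q \<in> ?Ps \<Longrightarrow> reachable ?Ps ?M Q (SV v) \<Longrightarrow>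
        prod_rel ?F ?Ps R Q (Inl (SV v)) (Inr t)"
      by blast
    have "rel u (SV v) t" if "u \<in> V" "{u, v} \<in> E \<or> u = v" for u
      unfolding rel_def using that v by (intro t(2) P) (simp_all add: reachable_graph_SV[OF G])
    with t(1) show ?thesis
      by blast
  qed
  then obtain g where g: "\<And>v. v \<in> V \<Longrightarrow> g v \<in> states N"
    "\<And>u v. v \<in> V \<Longrightarrow> u \<in> V \<Longrightarrow> {u, v} \<in> E \<or> u = v \<Longrightarrow> rel u (SV v) (g v)"
    by metis
  \<comment> \<open>Any vertex gives a path to \<open>S2\<close>. The answer \<open>z\<close>
    obtained along it is then related to \<open>S2\<close> under every product, whichever
    \<open>w\<close> was taken.\<close>
  obtain w where w: "w \<in> V"
    using G by (auto simp: finite_graph_def)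
  have "prod_step {Feature w} ?M (SV w) (Act ()) S2"
    using w by (auto simp: prod_step_graph[OF G w])
  from coherent_step[OF F bfb coh P[OF w] _ this, of "g w"]
  obtain z where "z \<in> states N" "\<And>Q. Q \<in> ?Ps \<Longrightarrow> reachable ?Ps ?M Q S2 \<Longrightarrow>
      prod_rel ?F ?Ps R Q (Inl S2) (Inr z)"
    using g(2)[OF w w] unfolding rel_def by blast
  then have z: "z \<in> states N" "\<And>u. u \<in> V \<Longrightarrow> rel u S2 z"
    unfolding rel_def using P reachable_graph_S2[OF G] by blast+

  have "g u \<noteq> g v" if "u \<in> V" "v \<in> V" "{u, v} \<in> E" for u v
  proof
    assume eq: "g u = g v"
    have "u \<noteq> v"
      using G that by (auto simp: finite_graph_def)
    moreover have "bisim u (SV u) (SV v)"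
      using g(2)[of u u] g(2)[of v u] that eq by (auto intro: bisimI)
    ultimately show False
      using not_SV_SV that by blast
  qed
  moreover have "finite V"
    using G by (simp add: finite_graph_def)
  ultimately obtain c where "proper_colouring V E (card (g ` V)) c"
    using proper_colouring_of_map by metis
  then have "chromatic_number V E \<le> card (g ` V)"
    unfolding chromatic_number_def by (blast intro: Least_le)
  \<comment> \<open>If \<open>init N\<close> were \<open>g v\<close>, it would witness that
    \<open>S1\<close> and \<open>SV v\<close> are bisimilar under the product of \<open>v\<close>.
    For \<open>z\<close> below, the states compared with \<open>S2\<close> are \<open>SV v\<close>
    and, under the product of \<open>w\<close>, \<open>S1\<close>.\<close>
  moreover have "init N \<notin> g ` V"
    using g(2) not_S1_SV rel_S1 bisimI by (metis imageE)
  moreover have "z \<notin> insert (init N) (g ` V)"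
    using g(2) not_SV_S2 not_S1_S2[OF w] rel_S1 z(2) w bisimI by (metis imageE insertE)
  ultimately have "chromatic_number V E + 2 \<le> card (insert z (insert (init N) (g ` V)))"
    using \<open>finite V\<close> by simp
  also have "\<dots> \<le> card (states N)"
    using N z(1) g(1) by (intro card_mono) (auto simp: is_fts_def)
  finally show ?thesis .
qed

section \<open>The two bounds combined\<close>

theorem theorem8:
  fixes V :: "'v set" and E :: "'v set set"
    and S' :: "('v feature, unit, 's) fts"
  assumes "finite_graph V E"
    and "minimal_coherent_bf_bisimilar (graph_features V) (graph_products V) (graph_fts V E) S'"
  shows "card (states S') = chromatic_number V E + 2"
proof -
  \<comment> \<open>Giving all vertices distinct colours shows that some proper colouring exists, so
    the least number of colours is attained.\<close>
  have "finite V" "\<And>u v. {u, v} \<in> E \<Longrightarrow> id u \<noteq> id v"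
    using assms(1) by (auto simp: finite_graph_def)
  then obtain c\<^sub>0 where "proper_colouring V E (card (id ` V)) c\<^sub>0"
    using proper_colouring_of_map by metis
  then have "\<exists>k c. proper_colouring V E k c"
    by blast
  from LeastI_ex[OF this] obtain c where "proper_colouring V E (chromatic_number V E) c"
    unfolding chromatic_number_def by blast
  then obtain L :: "('v feature, unit, nat) fts" where
    L: "is_fts (graph_features V) L" "finite (states L)"
    "card (states L) \<le> chromatic_number V E + 2"
    "coherent_bf_bisimilar (graph_features V) (graph_products V) (graph_fts V E) L"
    using colouring_bisimilar[OF assms(1)] by metis
  have S': "is_fts (graph_features V) S'" "states S' \<lesssim> states L"
    "coherent_bf_bisimilar (graph_features V) (graph_products V) (graph_fts V E) S'"
    using assms(2) L(1,4) unfolding minimal_coherent_bf_bisimilar_def by auto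
  then obtain f where f: "inj_on f (states S')" "f ` states S' \<subseteq> states L"
    by (auto simp: lepoll_def)
  \<comment> \<open>Minimality against the finite \<open>L\<close> makes \<open>S'\<close> finite,
    as \<open>bisimilar_card_ge\<close> requires; the same injection gives the upper bound.\<close>
  have "finite (states S')"
    using f L(2) by (rule inj_on_finite)
  then show ?thesis
    using bisimilar_card_ge[OF assms(1) S'(1) _ S'(3)] card_inj_on_le[OF f L(2)] L(3) by simp
qed

end
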